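(* Let $S$ be the infinite binary sequence $S=S_1S_2S_3\cdots$ defined in the context. Then the worst-case compression ratio of $\mathrm{PPM}^*$ on $S$ is $0$, i.e. $$R_{\mathrm{PPM}^*}(S)=\limsup_{m\to\infty}\frac{|\mathrm{PPM}^*(S\upharpoonright m)|}{m}=0.$$
   Context: Strings are indexed from $0$; $x[i..j]$ is the substring from position $i$ to $j$ (empty if $j<i$); $x^j$ is $j$-fold concatenation; $S\upharpoonright m$ is the length-$m$ prefix of $S$; $\log$ is base $2$. de Bruijn strings: for $n\ge 1$, a de Bruijn string of order $n$ is a binary string $x$ of length $2^n$ such that every $w\in\{0,1\}^n$ occurs exactly once as a substring of $x\cdot x[0..n-2]$. $db(n)$ is the lexicographically least one, produced by Martin's algorithm: start with $x=1^{n-1}$; while possible, append a bit (preferring $0$ over $1$) so that all length-$n$ substrings of $x$ remain distinct; when no bit can be appended, delete the prefix $1^{n-1}$. For $0\le i<2^n$, $db_i(n)=db(n)[i..2^n-1]\cdot db(n)[0..i-1]$. The sequence $S$: for $n\ge1$ write $n=2^st$ with $t$ odd, let $B_{n,i}=db_i(n)^t$ for $0\le i<2^s$, $S_n=B_{n,0}B_{n,1}\cdots B_{n,2^s-1}$ (so $|S_n|=n2^n$), and $S=S_1S_2S_3\cdots$. The $\mathrm{PPM}^*$ compressor (without exclusion, with escape Method C) on binary input: after reading a prefix $x$, its model stores "contexts" (strings $c$), each with a frequency count for each bit $b$ equal to the number of occurrences of $cb$ as a substring of $x$, and an escape count equal to the number of distinct bits that have followed $c$ in $x$. The empty context is always present,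 and contexts are extended until unique: whenever a string $w$ occurs at least twice in $x$, the context $wb$ is stored for each bit $b$ such that $wb$ occurs in $x$ followed by a further bit (a context is only created once it has a prediction). A context is deterministic if its escape count is $1$. To encode the next bit $b$, the relevant contexts are the stored contexts that are suffixes of $x$; the current context is the shortest deterministic relevant context, or the longest relevant context if none is deterministic. If $b$ has count $f>0$ in the current context, $b$ is encoded with probability $f/(T+e)$, where $T$ is the total bit count and $e$ the escape count of that context; otherwise an escape is encoded with probability $e/(T+e)$ and the next shorter relevant context becomes current; if $b$ is unseen even in the empty context, after the escape $b$ is encoded with probability $1/2$. The model is then updated. The output $\mathrm{PPM}^*(y)$ is an arithmetic code of all these probabilities, of length $\lceil -\log P\rceil+O(1)$ (at most one bit of overhead), where $P$ is the product of all probabilities used. *)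

theory Defs
  imports Complex_Main "HOL-Library.While_Combinator" "HOL-Library.Liminf_Limsup"
    "HOL-Library.Extended_Real" "HOL-Computational_Algebra.Primes"
begin

text \<open>Binary strings are bool lists: False = bit 0, True = bit 1.\<close>

section \<open>de Bruijn strings via Martin's algorithm\<close>

definition windows :: "nat \<Rightarrow> bool list \<Rightarrow> bool list list" where
  "windows n x = map (\<lambda>i. take n (drop i x)) [0..<Suc (length x) - n]"

definition martin_ok :: "nat \<Rightarrow> bool list \<Rightarrow> bool" where
  "martin_ok n x \<longleftrightarrow> distinct (windows n x)"

definition martin_can :: "nat \<Rightarrow> bool list \<Rightarrow> bool" where
  "martin_can n x \<longleftrightarrow> martin_ok n (x @ [False]) \<or> martin_ok n (x @ [True])"

definition martin_step :: "nat \<Rightarrow> bool list \<Rightarrow> bool list" where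
  "martin_step n x = (if martin_ok n (x @ [False]) then x @ [False] else x @ [True])"

definition db :: "nat \<Rightarrow> bool list" where
  "db n = drop (n - 1)
     (the (while_option (martin_can n) (martin_step n) (replicate (n - 1) True)))"

definition db_rot :: "nat \<Rightarrow> nat \<Rightarrow> bool list" where
  "db_rot n i = drop i (db n) @ take i (db n)"

definition two_exp :: "nat \<Rightarrow> nat" where
  "two_exp n = multiplicity (2::nat) n"

definition odd_part :: "nat \<Rightarrow> nat" where
  "odd_part n = n div 2 ^ two_exp n"

definition Bblock :: "nat \<Rightarrow> nat \<Rightarrow> bool list" where
  "Bblock n i = concat (replicate (odd_part n) (db_rot n i))"

definition Sblock :: "nat \<Rightarrow> bool list" where
  "Sblock n = concat (map (Bblock n) [0..<2 ^ two_exp n])"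

text \<open>Length-m prefix of S = S_1 S_2 S_3 ... (each S_n is nonempty, so S_1..S_m suffice).\<close>
definition S_prefix :: "nat \<Rightarrow> bool list" where
  "S_prefix m = take m (concat (map Sblock [1..<Suc m]))"

section \<open>PPM* (no exclusion, escape method C)\<close>

definition occ :: "bool list \<Rightarrow> bool list \<Rightarrow> nat" where
  "occ w x = card {i. i + length w \<le> length x \<and> take (length w) (drop i x) = w}"

definition freq :: "bool list \<Rightarrow> bool list \<Rightarrow> bool \<Rightarrow> nat" where
  "freq x c b = occ (c @ [b]) x"

definition tot :: "bool list \<Rightarrow> bool list \<Rightarrow> nat" where
  "tot x c = freq x c False + freq x c True"

definition esc :: "bool list \<Rightarrow> bool list \<Rightarrow> nat" where
  "esc x c = card {b. freq x c b > 0}"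

definition stored :: "bool list \<Rightarrow> bool list \<Rightarrow> bool" where
  "stored x c \<longleftrightarrow> c = [] \<or>
     (\<exists>w b. c = w @ [b] \<and> occ w x \<ge> 2 \<and> (\<exists>b'. occ (w @ [b, b']) x > 0))"

definition suf :: "bool list \<Rightarrow> nat \<Rightarrow> bool list" where
  "suf x k = drop (length x - k) x"

definition rel_lens :: "bool list \<Rightarrow> nat set" where
  "rel_lens x = {k. k \<le> length x \<and> stored x (suf x k)}"

definition cur_len :: "bool list \<Rightarrow> nat" where
  "cur_len x = (if \<exists>k\<in>rel_lens x. esc x (suf x k) = 1
                then Min {k\<in>rel_lens x. esc x (suf x k) = 1}
                else Max (rel_lens x))"

definition esc_prob :: "bool list \<Rightarrow> bool list \<Rightarrow> real" where
  "esc_prob x c = (if tot x c + esc x c = 0 then 1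
                   else real (esc x c) / real (tot x c + esc x c))"

fun code_chain :: "bool list \<Rightarrow> bool \<Rightarrow> nat list \<Rightarrow> real" where
  "code_chain x b [] = 1 / 2"
| "code_chain x b (k # ks) =
     (let c = suf x k in
      if freq x c b > 0 then real (freq x c b) / real (tot x c + esc x c)
      else esc_prob x c * code_chain x b ks)"

definition step_prob :: "bool list \<Rightarrow> bool \<Rightarrow> real" where
  "step_prob x b = code_chain x b
     (rev (sorted_list_of_set {k\<in>rel_lens x. k \<le> cur_len x}))"

definition ppm_prob :: "bool list \<Rightarrow> real" where
  "ppm_prob y = (\<Prod>k<length y. step_prob (take k y) (y ! k))"

end

theory Submission
  imports Defs "HOL-Real_Asymp.Real_Asymp"
begin

text \<open>The block of index n consists of n passes over rotations of db(n). All words of length n - 2 occur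
  before it, so the current context never has length below n - 3; words of that length occur only
  polynomially often, hence every bit of the block costs O(log n). From the second pass on, take
  the context c reaching back to the start of the pass, for all but the first and last n bits.
  If c has never been followed by the wrong bit, the shortest deterministic context predicts
  correctly with frequency at least p in pass p
  (counted from 0), at cost at most log(1 + 1/p), which telescopes to log n over the passes.
  Otherwise the divergence is witnessed by an occurrence of the first n bits of the pass; distinct
  failures have distinct witnesses, so there are only polynomially many. In total the block costs
  O(2^n log n), against its length n 2^n.\<close>

section \<open>Counting occurrences\<close>

definition occ_at :: "bool list \<Rightarrow> bool list \<Rightarrow> nat set" where
  "occ_at w x = {i. i + length w \<le> length x \<and> take (length w) (drop i x) = w}"

lemma occ_eq_card: "occ w x = card (occ_at w x)"
  by (simp add: occ_def occ_at_def)

lemma finite_occ_at [simp]: "finite (occ_at w x)"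
  by (rule finite_subset[of _ "{..length x}"]) (auto simp: occ_at_def)

lemma occ_at_iff: "i \<in> occ_at w x \<longleftrightarrow> (\<exists>u v. x = u @ w @ v \<and> length u = i)"
proof
  assume "i \<in> occ_at w x"
  then have len: "i + length w \<le> length x" and w: "take (length w) (drop i x) = w"
    by (auto simp: occ_at_def)
  have "x = take i x @ take (length w) (drop i x) @ drop (length w) (drop i x)"
    by (metis append_take_drop_id)
  with w len show "\<exists>u v. x = u @ w @ v \<and> length u = i"
    by (intro exI[of _ "take i x"] exI[of _ "drop (length w) (drop i x)"]) auto
qed (auto simp: occ_at_def)

lemma occ_atE:
  assumes "i \<in> occ_at w x"
  obtains u v where "x = u @ w @ v" "length u = i"
  using assms by (auto simp: occ_at_iff)

lemma occ_at_predecessor: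
  assumes "i \<in> occ_at w x" "0 < i"
  shows "\<exists>a. i - 1 \<in> occ_at (a # w) x"
proof -
  obtain u z where uz: "x = u @ w @ z" "length u = i"
    using assms(1) by (rule occ_atE)
  with assms(2) obtain u' a where "u = u' @ [a]"
    by (cases u rule: rev_cases) auto
  with uz have "x = u' @ (a # w) @ z" "length u' = i - 1" by auto
  then show ?thesis unfolding occ_at_iff by blast
qed

lemma occ_pos_iff: "occ w x > 0 \<longleftrightarrow> (\<exists>u v. x = u @ w @ v)"
proof -
  have "occ w x > 0 \<longleftrightarrow> occ_at w x \<noteq> {}"
    by (simp add: occ_eq_card card_gt_0_iff)
  then show ?thesis
    using occ_at_iff[of _ w x] by blast
qed

lemma occ_posI: "x = u @ w @ v \<Longrightarrow> occ w x > 0"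
  unfolding occ_pos_iff by blast

text \<open>The term \<open>length w\<close> pays for the occurrences across the seam, which start
  among the last \<open>length w\<close> positions of \<open>u\<close>.\<close>

lemma occ_append_le: "occ w (u @ v) \<le> occ w u + occ w v + length w"
proof -
  let ?C = "{length u - length w..<length u}"
  let ?B = "(\<lambda>i. i + length u) ` occ_at w v"
  have "occ_at w (u @ v) \<subseteq> occ_at w u \<union> ?B \<union> ?C"
  proof
    fix i assume i: "i \<in> occ_at w (u @ v)"
    consider "i + length w \<le> length u" | "length u \<le> i" | "i < length u" "length u < i + length w"
      by linarith
    then show "i \<in> occ_at w u \<union> ?B \<union> ?C"
    proof cases
      case 1
      with i show ?thesis by (auto simp: occ_at_def)
    next
      case 2
      with i have "i - length u \<in> occ_at w v" by (auto simp: occ_at_def)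
      with 2 have "i \<in> ?B" by (intro image_eqI[of _ _ "i - length u"]) auto
      then show ?thesis by blast
    next
      case 3
      then show ?thesis by auto
    qed
  qed
  then have "card (occ_at w (u @ v)) \<le> card (occ_at w u \<union> ?B \<union> ?C)"
    by (intro card_mono) auto
  also have "\<dots> \<le> card (occ_at w u) + card ?B + card ?C"
    by (meson card_Un_le add_le_mono1 order_trans)
  also have "card ?B \<le> card (occ_at w v)"
    by (rule card_image_le) simp
  also have "card ?C \<le> length w"
    by simp
  finally show ?thesis by (simp add: occ_eq_card)
qed

text \<open>Nonemptiness matters: the empty word occurs at the seam in both parts and would be
  counted twice.\<close>

lemma occ_append_ge:
  assumes "w \<noteq> []"
  shows "occ w u + occ w v \<le> occ w (u @ v)"
proof -
  let ?B = "(\<lambda>i. i + length u) ` occ_at w v"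
  have "card (occ_at w u) + card (occ_at w v) = card (occ_at w u) + card ?B"
    by (simp add: card_image)
  also have "\<dots> = card (occ_at w u \<union> ?B)"
    using assms by (intro card_Un_disjoint[symmetric] finite_occ_at finite_imageI) (auto simp: occ_at_def[of w u])
  also have "\<dots> \<le> card (occ_at w (u @ v))"
    by (intro card_mono[OF finite_occ_at]) (auto simp: occ_at_def)
  finally show ?thesis by (simp add: occ_eq_card)
qed

lemma occ_append1: "occ w u \<le> occ w (u @ v)"
  unfolding occ_eq_card by (rule card_mono[OF finite_occ_at]) (auto simp: occ_at_def)

lemma occ_append2: "occ w v \<le> occ w (u @ v)"
proof -
  have "occ w v = card ((\<lambda>i. i + length u) ` occ_at w v)"
    by (simp add: card_image occ_eq_card)
  also have "\<dots> \<le> occ w (u @ v)"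
    unfolding occ_eq_card by (intro card_mono[OF finite_occ_at]) (auto simp: occ_at_def)
  finally show ?thesis .
qed

lemma occ_prefix_le: "occ (w @ z) x \<le> occ w x"
  unfolding occ_eq_card by (rule card_mono) (force simp: occ_at_iff)+

lemma occ_take_le: "occ w x \<le> occ (take k w) x"
  by (metis append_take_drop_id occ_prefix_le)

lemma occ_suffix_le: "occ (z @ w) x \<le> occ w x"
proof -
  have "occ (z @ w) x = card ((\<lambda>i. i + length z) ` occ_at (z @ w) x)"
    by (simp add: card_image occ_eq_card)
  also have "\<dots> \<le> occ w x"
    unfolding occ_eq_card
  proof (intro card_mono image_subsetI)
    fix i assume "i \<in> occ_at (z @ w) x"
    then obtain u v where "x = u @ (z @ w) @ v" "length u = i"
      by (rule occ_atE)
    then show "i + length z \<in> occ_at w x"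
      unfolding occ_at_iff by (intro exI[of _ "u @ z"] exI[of _ v]) auto
  qed simp
  finally show ?thesis .
qed

lemma tot_le_occ: "tot x c \<le> occ c x"
proof -
  have "tot x c = card (occ_at (c @ [False]) x \<union> occ_at (c @ [True]) x)"
    unfolding tot_def freq_def occ_eq_card
    by (subst card_Un_disjoint) (auto simp: occ_at_iff append_eq_append_conv)
  also have "\<dots> \<le> occ c x"
    unfolding occ_eq_card by (rule card_mono) (force simp: occ_at_iff)+
  finally show ?thesis .
qed

text \<open>Only an occurrence at the very end of \<open>x\<close> has no next bit; it accounts for
  the summand 1.\<close>

lemma occ_snoc_le: "occ c x \<le> 1 + occ (c @ [False]) x + occ (c @ [True]) x"
proof -
  have "occ_at c x \<subseteq> {length x - length c} \<union> occ_at (c @ [False]) x \<union> occ_at (c @ [True]) x"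
  proof
    fix i assume "i \<in> occ_at c x"
    then obtain u v where x: "x = u @ c @ v" "length u = i"
      by (rule occ_atE)
    show "i \<in> {length x - length c} \<union> occ_at (c @ [False]) x \<union> occ_at (c @ [True]) x"
    proof (cases v)
      case Nil
      with x show ?thesis by auto
    next
      case (Cons b v')
      with x have "i \<in> occ_at (c @ [b]) x" by (auto simp: occ_at_iff)
      then show ?thesis by (cases b) auto
    qed
  qed
  then have "occ c x \<le> card ({length x - length c} \<union> occ_at (c @ [False]) x \<union> occ_at (c @ [True]) x)"
    unfolding occ_eq_card by (intro card_mono) auto
  also have "\<dots> \<le> card {length x - length c} + occ (c @ [False]) x + occ (c @ [True]) x"
    unfolding occ_eq_card by (meson card_Un_le add_le_mono1 order_trans)
  finally show ?thesis by simp
qed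

lemma occ_concat_le: "occ w (concat ps) \<le> (\<Sum>p\<leftarrow>ps. occ w p + length w) + (if w = [] then 1 else 0)"
proof (induction ps)
  case Nil
  then show ?case by (auto simp: occ_eq_card occ_at_def)
next
  case (Cons p ps)
  then show ?case using occ_append_le[of w p "concat ps"] by simp
qed

section \<open>Martin's algorithm\<close>

lemma martin_okD:
  assumes "martin_ok n x" "length w = n" "i \<in> occ_at w x" "j \<in> occ_at w x"
  shows "i = j"
proof -
  have "windows n x ! i = w" "windows n x ! j = w" "i < length (windows n x)" "j < length (windows n x)"
    using assms(2-4) by (auto simp: windows_def occ_at_def)
  with assms(1) show ?thesis
    by (metis martin_ok_def nth_eq_iff_index_eq)
qed

lemma occ_le_1_if_martin_ok:
  assumes "martin_ok n x" "length w = n"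
  shows "occ w x \<le> 1"
  unfolding occ_eq_card One_nat_def
  using martin_okD[OF assms] by (subst card_le_Suc0_iff_eq) auto

text \<open>Appending a bit adds exactly one window, the last one, so distinctness can only fail
  because that window occurred before.\<close>

lemma martin_ok_snocD:
  assumes ok: "martin_ok n x" and nok: "\<not> martin_ok n (x @ [b])"
    and x: "x = p @ v" and v: "Suc (length v) = n"
  shows "occ (v @ [b]) x > 0"
proof -
  have len: "Suc (length (x @ [b])) - n = Suc (Suc (length x) - n)"
    using x v by simp
  have "windows n (x @ [b]) = windows n x @ [v @ [b]]"
  proof -
    have "take n (drop i (x @ [b])) = take n (drop i x)" if "i < Suc (length x) - n" for i
      using that by simp
    moreover have "take n (drop (Suc (length x) - n) (x @ [b])) = v @ [b]"
      using x v by auto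
    ultimately show ?thesis
      unfolding windows_def len by simp
  qed
  with ok nok have "v @ [b] \<in> set (windows n x)"
    by (auto simp: martin_ok_def)
  then obtain i where i: "i < Suc (length x) - n" "v @ [b] = take n (drop i x)"
    by (auto simp: windows_def)
  have "i \<in> occ_at (v @ [b]) x"
    unfolding occ_at_def using i v by auto
  then show ?thesis unfolding occ_eq_card by (auto simp: card_gt_0_iff)
qed

text \<open>The seed 1^(n-1) is kept here: distinctness of windows is an invariant of this longer
  string, and for n >= 2 the windows overlapping the seed are needed to reach all words of length
  n.\<close>

definition mstr :: "nat \<Rightarrow> bool list" where
  "mstr n = the (while_option (martin_can n) (martin_step n) (replicate (n - 1) True))"

text \<open>The last clause records greediness: a 1 is appended only where a 0 would repeat a
  window. At the start it holds vacuously, the seed being too short to contain a window.\<close>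

definition martin_inv :: "nat \<Rightarrow> bool list \<Rightarrow> bool" where
  "martin_inv n x \<longleftrightarrow> martin_ok n x \<and> (\<exists>y. x = replicate (n - 1) True @ y) \<and>
     (\<forall>u. length u = n - 1 \<longrightarrow> occ (u @ [True]) x > 0 \<longrightarrow> occ (u @ [False]) x > 0)"

lemma occ_snoc_pos_cases:
  assumes "occ (w @ [a]) (x @ [b]) > 0"
  shows "occ (w @ [a]) x > 0 \<or> (a = b \<and> (\<exists>p. x = p @ w))"
proof -
  obtain u v where uv: "x @ [b] = u @ (w @ [a]) @ v"
    using assms occ_pos_iff by blast
  show ?thesis
  proof (cases v rule: rev_cases)
    case Nil
    with uv show ?thesis by auto
  next
    case (snoc v' c)
    with uv have "x = u @ (w @ [a]) @ v'" by auto
    then have "occ (w @ [a]) x > 0" by (rule occ_posI)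
    then show ?thesis ..
  qed
qed

lemma martin_inv_step:
  assumes n: "n \<ge> 1" and inv: "martin_inv n x" and can: "martin_can n x"
  shows "martin_inv n (martin_step n x)"
proof -
  obtain b where b: "martin_step n x = x @ [b]" "b \<longleftrightarrow> \<not> martin_ok n (x @ [False])"
    by (auto simp: martin_step_def)
  have ok: "martin_ok n (x @ [b])"
    using b can by (cases b) (auto simp: martin_can_def)
  have "occ (u @ [False]) (x @ [b]) > 0"
    if u: "length u = n - 1" and pos: "occ (u @ [True]) (x @ [b]) > 0" for u
  proof -
    have "occ (u @ [False]) x > 0"
      using occ_snoc_pos_cases[OF pos]
    proof
      assume "occ (u @ [True]) x > 0"
      then show ?thesis using inv u by (auto simp: martin_inv_def)
    next
      assume "True = b \<and> (\<exists>p. x = p @ u)"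
      with b u n inv show ?thesis
        by (auto simp: martin_inv_def intro!: martin_ok_snocD[of n])
    qed
    then show ?thesis
      using occ_append1[of "u @ [False]" x "[b]"] by linarith
  qed
  with ok inv show ?thesis
    unfolding b(1) martin_inv_def by auto
qed

lemma card_bool_lists: "card {w :: bool list. length w = n} = 2 ^ n"
  using card_lists_length_eq[of "UNIV :: bool set" n] by (simp add: card_UNIV_bool)

lemma finite_bool_lists: "finite {w :: bool list. length w = n}"
  using finite_lists_length_eq[of "UNIV :: bool set" n] by simp

lemma martin_ok_length_le:
  assumes "martin_ok n x"
  shows "Suc (length x) - n \<le> 2 ^ n"
proof -
  have "Suc (length x) - n = card (set (windows n x))"
    using assms distinct_card[of "windows n x"] by (simp add: martin_ok_def windows_def)
  also have "\<dots> \<le> card {w :: bool list. length w = n}"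
    by (intro card_mono finite_bool_lists) (auto simp: windows_def)
  finally show ?thesis by (simp add: card_bool_lists)
qed

lemma mstr_props:
  assumes n: "n \<ge> 1"
  shows "martin_inv n (mstr n)" "\<not> martin_can n (mstr n)"
proof -
  let ?s = "replicate (n - 1) True"
  have init: "martin_inv n ?s"
  proof -
    have "occ (u @ [True]) ?s = 0" if "length u = n - 1" for u
    proof -
      have "occ_at (u @ [True]) ?s = {}"
        using that n by (auto simp: occ_at_def)
      then show ?thesis by (simp add: occ_eq_card)
    qed
    with n show ?thesis
      by (auto simp: martin_inv_def martin_ok_def windows_def)
  qed
  \<comment> \<open>Each iteration adds a bit, and by \<open>martin_ok_length_le\<close> the length
    stays below 2^n + n, so the truncated difference used as measure strictly decreases.\<close>
  have "\<exists>t. while_option (martin_can n) (martin_step n) ?s = Some t"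
  proof (rule measure_while_option_Some[where P = "martin_inv n" and f = "\<lambda>x. 2 ^ n + n - length x"])
    fix x assume x: "martin_inv n x" "martin_can n x"
    have inv: "martin_inv n (martin_step n x)"
      using martin_inv_step[OF n x] .
    then have "Suc (length (martin_step n x)) - n \<le> 2 ^ n"
      by (intro martin_ok_length_le) (simp add: martin_inv_def)
    moreover have "length (martin_step n x) = Suc (length x)"
      by (simp add: martin_step_def)
    ultimately show "martin_inv n (martin_step n x) \<and>
        2 ^ n + n - length (martin_step n x) < 2 ^ n + n - length x"
      using inv by auto
  qed (rule init)
  then obtain t where t: "while_option (martin_can n) (martin_step n) ?s = Some t"
    by blast
  then have "mstr n = t" by (simp add: mstr_def)
  moreover have "martin_inv n t"
    using while_option_rule[where P = "martin_inv n", OF _ t init] martin_inv_step[OF n] by blast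
  moreover have "\<not> martin_can n t"
    using while_option_stop[OF t] .
  ultimately show "martin_inv n (mstr n)" "\<not> martin_can n (mstr n)" by auto
qed

text \<open>The bits preceding the two occurrences of \<open>v\<close> differ, since otherwise a
  window would repeat; hence both bits precede \<open>v\<close> somewhere. Position 0 is excluded
  because nothing precedes it.\<close>

lemma occ_Cons_if_two_positions:
  assumes ok: "martin_ok (Suc (length v)) x"
    and ij: "i \<in> occ_at v x" "j \<in> occ_at v x" "i \<noteq> j" "0 < i" "0 < j"
  shows "occ (b # v) x > 0"
proof -
  obtain a a' where a: "i - 1 \<in> occ_at (a # v) x" "j - 1 \<in> occ_at (a' # v) x"
    using occ_at_predecessor ij by metis
  have "a \<noteq> a'"
  proof
    assume "a = a'"
    then have "i - 1 = j - 1"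
      using martin_okD[OF ok _ a(1)] a(2) by simp
    with ij show False by simp
  qed
  then have "b = a \<or> b = a'" by blast
  with a show ?thesis
    unfolding occ_eq_card card_gt_0_iff by auto
qed

text \<open>Once both continuations of the final window occur, a window other than the initial one would
  have three predecessors; hence the algorithm halts at the all-ones window. Every node then
  inherits both outgoing edges from its successor along appended ones, since greediness makes
  an edge labelled 1 imply its sibling labelled 0.\<close>

lemma mstr_complete:
  assumes n: "n \<ge> 1" and w: "length w = n"
  shows "occ w (mstr n) > 0"
proof -
  define x where "x = mstr n"
  have inv: "martin_inv n x" and stop: "\<not> martin_can n x"
    using mstr_props[OF n] by (auto simp: x_def)
  from inv obtain y where y: "x = replicate (n - 1) True @ y" and ok: "martin_ok n x"
    and greedy: "\<And>u. length u = n - 1 \<Longrightarrow> occ (u @ [True]) x > 0 \<Longrightarrow> occ (u @ [False]) x > 0"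
    by (auto simp: martin_inv_def)
  \<comment> \<open>\<open>e\<close> is where the last n - 1 bits of \<open>x\<close> start; an
    occurrence of a word of length n - 1 starts before \<open>e\<close> exactly when a bit follows
    it.\<close>
  define e where "e = length x - (n - 1)"
  define v where "v = drop e x"
  have xv: "x = take e x @ v" by (simp add: v_def)
  have lv: "Suc (length v) = n" using n y by (auto simp: v_def e_def)
  have "length (take e x) = e" by (simp add: e_def)
  with xv have evx: "e \<in> occ_at v x"
    unfolding occ_at_iff by (metis append_Nil2)
  \<comment> \<open>Halting means that neither bit can be appended, so both extensions of the final
    n - 1 bits occur already.\<close>
  have vb: "occ (v @ [b]) x > 0" for b
    using stop martin_ok_snocD[OF ok _ xv lv, of b]
    by (cases b) (auto simp: martin_can_def)
  have occ_at_ne: "occ u x > 0 \<Longrightarrow> occ_at u x \<noteq> {}" for u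
    by (auto simp: occ_eq_card)
  have zero: "u = replicate (n - 1) True" if "0 \<in> occ_at u x" "length u = n - 1" for u
    using that y by (auto simp: occ_at_def)
  have two: "\<exists>i j. i \<in> occ_at u x \<and> j \<in> occ_at u x \<and> i \<noteq> j \<and> i < e \<and> j < e"
    if full: "\<And>b. occ (u @ [b]) x > 0" and u: "length u = n - 1" for u
  proof -
    obtain i j where i: "i \<in> occ_at (u @ [False]) x" and j: "j \<in> occ_at (u @ [True]) x"
      using occ_at_ne[OF full] by blast
    from i have "i \<in> occ_at u x" "i < e" "x ! (i + (n - 1)) = False"
      using u by (force simp: occ_at_iff e_def nth_append)+
    moreover from j have "j \<in> occ_at u x" "j < e" "x ! (j + (n - 1)) = True"
      using u by (force simp: occ_at_iff e_def nth_append)+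
    ultimately show ?thesis by metis
  qed
  have v: "v = replicate (n - 1) True"
  proof (rule ccontr)
    assume nv: "v \<noteq> replicate (n - 1) True"
    have lv': "length v = n - 1" using lv by simp
    have pos: "k \<in> occ_at v x \<Longrightarrow> 0 < k" for k
      using zero[OF _ lv'] nv by (cases k) auto
    obtain i j where ij: "i \<in> occ_at v x" "j \<in> occ_at v x" "i \<noteq> j" "i < e" "j < e"
      using two[OF vb lv'] by blast
    obtain a b c where abc: "i - 1 \<in> occ_at (a # v) x" "j - 1 \<in> occ_at (b # v) x"
      "e - 1 \<in> occ_at (c # v) x"
      using occ_at_predecessor pos ij(1,2) evx by metis
    have "a = b \<or> a = c \<or> b = c" by auto
    with abc have "i - 1 = j - 1 \<or> i - 1 = e - 1 \<or> j - 1 = e - 1"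
      using martin_okD[OF ok, of "_ # v"] lv by auto
    with ij pos[OF ij(1)] pos[OF ij(2)] show False by auto
  qed
  \<comment> \<open>Both extensions of \<open>u\<close> give two occurrences before
    \<open>e\<close>. One at position 0 has no predecessor, but only the word of ones occurs there,
    and for that word the final occurrence at \<open>e\<close> is a substitute.\<close>
  have preds: "occ (a # u) x > 0"
    if full: "\<And>b. occ (u @ [b]) x > 0" and u: "length u = n - 1" for a u
  proof -
    obtain i j where ij: "i \<in> occ_at u x" "j \<in> occ_at u x" "i \<noteq> j" "i < e" "j < e"
      using two[OF full u] by blast
    have ok': "martin_ok (Suc (length u)) x" using ok u n by simp
    show ?thesis
    proof (cases "u = replicate (n - 1) True")
      case True
      then have e: "e \<in> occ_at u x" using evx v by simp
      show ?thesis
      proof (cases "i = 0")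
        case True
        then show ?thesis
          using occ_Cons_if_two_positions[OF ok' ij(2) e] ij by auto
      next
        case False
        then show ?thesis
          using occ_Cons_if_two_positions[OF ok' ij(1) e] ij by auto
      qed
    next
      case False
      then have "0 < i" "0 < j"
        using zero[OF _ u] ij by (cases i; auto; cases j; auto)+
      with ij show ?thesis
        using occ_Cons_if_two_positions[OF ok'] by blast
    qed
  qed
  \<comment> \<open>Induction on the number of bits before the run of ones. Dropping the first bit
    of a word and appending 1 leads to a word settled at the previous stage; \<open>preds\<close>
    makes this edge present and \<open>greedy\<close> adds the edge labelled 0.\<close>
  have all: "occ (u @ replicate (n - 1 - k) True @ [b]) x > 0"
    if "length u = k" "k \<le> n - 1" for u k b
    using that
  proof (induction k arbitrary: u b)
    case 0
    then show ?case using vb v by simp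
  next
    case (Suc k)
    then obtain a u' where u: "u = a # u'" "length u' = k"
      by (cases u) auto
    have "occ (a # (u' @ replicate (n - 1 - k) True)) x > 0"
      using Suc.IH[OF u(2)] Suc.prems u by (intro preds) auto
    moreover have "a # (u' @ replicate (n - 1 - k) True)
        = (u @ replicate (n - 1 - Suc k) True) @ [True]"
    proof -
      have "n - 1 - k = Suc (n - 1 - Suc k)" using Suc.prems by simp
      then show ?thesis using u
        by (simp add: replicate_append_same)
    qed
    ultimately have "occ ((u @ replicate (n - 1 - Suc k) True) @ [True]) x > 0" by simp
    moreover from this have "occ ((u @ replicate (n - 1 - Suc k) True) @ [False]) x > 0"
      using Suc.prems by (intro greedy) auto
    ultimately show ?case by (cases b) auto
  qed
  from w n obtain u b where "w = u @ [b]" "length u = n - 1"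
    by (cases w rule: rev_cases) auto
  with all[of u "n - 1" b] show ?thesis by (simp add: x_def)
qed

section \<open>Length of db(n) and word counts in it\<close>

lemma db_mstr: "n \<ge> 1 \<Longrightarrow> mstr n = replicate (n - 1) True @ db n"
  using mstr_props(1)[of n] unfolding db_def mstr_def[symmetric] by (auto simp: martin_inv_def)

text \<open>The windows of \<open>mstr n\<close> are distinct and exhaust the words of length n, so
  there are 2^n of them; the seed accounts for the other n - 1 bits of
  \<open>mstr n\<close>.\<close>

lemma length_db:
  assumes "n \<ge> 1"
  shows "length (db n) = 2 ^ n"
proof -
  have ok: "martin_ok n (mstr n)" using mstr_props[OF assms] by (simp add: martin_inv_def)
  have "w \<in> set (windows n (mstr n))" if "length w = n" for w
  proof -
    have "occ_at w (mstr n) \<noteq> {}"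
      using mstr_complete[OF assms that] by (auto simp: occ_eq_card)
    then obtain i where "i \<in> occ_at w (mstr n)" by blast
    then have "w = (\<lambda>i. take n (drop i (mstr n))) i" "i < Suc (length (mstr n)) - n"
      using that by (auto simp: occ_at_def)
    then show ?thesis
      unfolding windows_def set_map by (intro image_eqI[of _ _ i]) auto
  qed
  then have "set (windows n (mstr n)) = {w. length w = n}"
    by (auto simp: windows_def)
  then have "length (windows n (mstr n)) = 2 ^ n"
    using ok card_bool_lists[of n] distinct_card by (metis martin_ok_def)
  then show ?thesis
    using assms by (simp add: windows_def db_mstr)
qed

text \<open>The word is padded to length n with a leading 0, which cannot lie in the seed of ones;
  the occurrence of the padded word therefore starts after the seed.\<close>

lemma occ_db_pos:
  assumes n: "n \<ge> 1" and w: "length w < n"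
  shows "occ w (db n) > 0"
proof -
  define z where "z = replicate (n - 1 - length w) False"
  have z: "length (w @ z) = n - 1"
    using w by (simp add: z_def)
  have "occ (False # w @ z) (mstr n) > 0"
    using z n by (intro mstr_complete) auto
  then obtain u v where uv: "replicate (n - 1) True @ db n = u @ (False # w @ z) @ v"
    unfolding occ_pos_iff db_mstr[OF n] by blast
  have "n - 1 \<le> length u"
  proof (rule ccontr)
    assume "\<not> n - 1 \<le> length u"
    then have "(replicate (n - 1) True @ db n) ! length u = True"
      by (simp add: nth_append)
    with uv show False by simp
  qed
  then have "db n = (drop (n - 1) u @ [False]) @ w @ (z @ v)"
    using arg_cong[OF uv, of "drop (n - 1)"] by simp
  then show ?thesis by (rule occ_posI)
qed

text \<open>Words of length at least n occur at most once in \<open>mstr n\<close>. Each letter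
  removed at most doubles the bound and adds 1 for an occurrence at the end, hence 2^(d+1) - 1 for d
  missing letters.\<close>

lemma occ_db_le:
  assumes n: "n \<ge> 1" and w: "n \<le> length w + d"
  shows "occ w (db n) \<le> 2 ^ Suc d - 1"
proof -
  have ok: "martin_ok n (mstr n)" using mstr_props[OF n] by (simp add: martin_inv_def)
  have "occ w (mstr n) \<le> 2 ^ Suc d - 1"
    using w
  proof (induction d arbitrary: w)
    case 0
    have "occ w (mstr n) \<le> occ (take n w) (mstr n)" by (rule occ_take_le)
    also have "\<dots> \<le> 1" using 0 by (intro occ_le_1_if_martin_ok[OF ok]) simp
    finally show ?case by simp
  next
    case (Suc d)
    have "occ (w @ [b]) (mstr n) \<le> 2 ^ Suc d - 1" for b
      using Suc by simp
    from this[of False] this[of True] occ_snoc_le[of w "mstr n"]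
    have "occ w (mstr n) \<le> 1 + 2 * (2 ^ Suc d - 1)" by linarith
    also have "\<dots> \<le> 2 ^ Suc (Suc d) - 1"
      by (simp add: algebra_simps) (use one_le_power[of "2::nat" d] in linarith)
    finally show ?case .
  qed
  then show ?thesis
    using occ_append2[of w "db n"] db_mstr[OF n] by (metis order_trans)
qed

section \<open>The blocks of S as passes over db(n)\<close>

lemma two_exp_odd_part: "n \<ge> 1 \<Longrightarrow> 2 ^ two_exp n * odd_part n = n"
  unfolding odd_part_def two_exp_def by (simp add: multiplicity_dvd)

lemma concat_replicate_blocks:
  "concat (map (\<lambda>i. concat (replicate t (f i))) [0..<K]) = concat (map (\<lambda>p. f (p div t)) [0..<K * t])"
proof (induction K)
  case (Suc K)
  have "map (\<lambda>p. f (p div t)) [K * t..<K * t + t] = replicate t (f K)"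
    by (rule nth_equalityI) auto
  moreover have "[0..<Suc K * t] = [0..<K * t] @ [K * t..<K * t + t]"
    using upt_add_eq_append[of 0 "K * t" t] by (simp add: add.commute)
  ultimately show ?case using Suc by simp
qed simp

text \<open>S_n consists of 2^s t = n copies of rotations, where t is \<open>odd_part n\<close>; the
  rotation advances by one position only every t copies, hence the quotient.\<close>

definition pass :: "nat \<Rightarrow> nat \<Rightarrow> bool list" where
  "pass n p = db_rot n (p div odd_part n)"

lemma Sblock_passes: "n \<ge> 1 \<Longrightarrow> Sblock n = concat (map (pass n) [0..<n])"
  unfolding Sblock_def Bblock_def pass_def
  using concat_replicate_blocks[of "odd_part n" "db_rot n" "2 ^ two_exp n"] two_exp_odd_part[of n]
  by (simp add: mult.commute)

lemma length_pass: "n \<ge> 1 \<Longrightarrow> length (pass n p) = 2 ^ n"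
  by (simp add: pass_def db_rot_def length_db)

lemma occ_pass_le: "occ w (pass n p) \<le> 2 * occ w (db n) + length w"
proof -
  define i where "i = p div odd_part n"
  have "occ w (pass n p) \<le> occ w (drop i (db n)) + occ w (take i (db n)) + length w"
    unfolding pass_def db_rot_def i_def by (rule occ_append_le)
  moreover have "occ w (drop i (db n)) \<le> occ w (db n)" "occ w (take i (db n)) \<le> occ w (db n)"
    by (metis append_take_drop_id occ_append1 occ_append2)+
  ultimately show ?thesis by linarith
qed

section \<open>Word counts in the completed blocks\<close>

definition S_upto :: "nat \<Rightarrow> bool list" where
  "S_upto n = concat (map Sblock [1..<Suc n])"

lemma S_upto_0 [simp]: "S_upto 0 = []"
  by (simp add: S_upto_def)

lemma S_upto_Suc: "S_upto (Suc n) = S_upto n @ Sblock (Suc n)"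
  by (simp add: S_upto_def)

lemma length_Sblock: "n \<ge> 1 \<Longrightarrow> length (Sblock n) = n * 2 ^ n"
  by (simp add: Sblock_passes length_concat comp_def length_pass sum_list_triv)

text \<open>For words at most 3 letters short of n, \<open>occ_db_le\<close> with d = 3 gives at
  most 15 occurrences in db(n), so a pass and its seam contribute at most 30 + 2 *
  \<open>length w\<close>. A block has at most n passes, the factor n + 1 also covers the seam
  between blocks, and there are n blocks.\<close>

definition ctx_bound :: "nat \<Rightarrow> nat" where
  "ctx_bound n = n * (n + 1) * (30 + 2 * n)"

lemma occ_Sblock_le:
  assumes "j \<ge> 1" "w \<noteq> []" "j \<le> length w + 3"
  shows "occ w (Sblock j) \<le> j * (30 + 2 * length w)"
proof -
  have "occ w (pass j p) + length w \<le> 30 + 2 * length w" for p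
    using occ_pass_le[of w j p] occ_db_le[of j w 3] assms by simp
  then have "(\<Sum>p\<leftarrow>[0..<j]. occ w (pass j p) + length w) \<le> (\<Sum>p\<leftarrow>[0..<j]. 30 + 2 * length w)"
    by (intro sum_list_mono) auto
  then show ?thesis
    using occ_concat_le[of w "map (pass j) [0..<j]"] assms
    by (simp add: Sblock_passes comp_def sum_list_triv)
qed

lemma occ_S_upto_le:
  assumes "w \<noteq> []" "n \<le> length w + 3" "length w \<le> n"
  shows "occ w (S_upto n) \<le> ctx_bound n"
proof -
  have "occ w (S_upto m) \<le> m * ((n + 1) * (30 + 2 * length w))" if "m \<le> n" for m
    using that
  proof (induction m)
    case 0
    then show ?case using assms by (simp add: occ_def)
  next
    case (Suc m)
    have "occ w (Sblock (Suc m)) \<le> Suc m * (30 + 2 * length w)"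
      using assms Suc.prems by (intro occ_Sblock_le) auto
    also have "\<dots> \<le> n * (30 + 2 * length w)"
      using Suc.prems by (intro mult_right_mono) auto
    finally have "occ w (Sblock (Suc m)) + length w \<le> (n + 1) * (30 + 2 * length w)"
      by simp
    then show ?case
      using Suc occ_append_le[of w "S_upto m" "Sblock (Suc m)"] by (simp add: S_upto_Suc)
  qed
  from this[of n] have "occ w (S_upto n) \<le> n * ((n + 1) * (30 + 2 * length w))" by simp
  also have "\<dots> \<le> ctx_bound n"
    using assms unfolding ctx_bound_def mult.assoc by (intro mult_left_mono) auto
  finally show ?thesis .
qed

text \<open>The first pass of the last block is db(n) unrotated, which already contains every
  shorter word.\<close>

lemma occ_S_upto_pos:
  assumes "n \<ge> 1" "length w < n"
  shows "occ w (S_upto n) > 0"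
proof -
  obtain m where m: "n = Suc m" using assms by (cases n) auto
  have "pass n 0 = db n" by (simp add: pass_def db_rot_def)
  then have "Sblock n = db n @ concat (map (pass n) [1..<n])"
    using Sblock_passes[OF assms(1)] assms(1) upt_conv_Cons[of 0 n] by simp
  then have "occ w (db n) \<le> occ w (S_upto n)"
    unfolding m S_upto_Suc by (metis occ_append1 occ_append2 order_trans)
  with occ_db_pos[OF assms] show ?thesis by linarith
qed

section \<open>Coding cost of a single bit\<close>

lemma suf_append [simp]: "suf (x @ c) (length c) = c"
  by (simp add: suf_def)

lemma suf_0 [simp]: "suf x 0 = []"
  by (simp add: suf_def)

lemma take_append_suf: "take (length x - k) x @ suf x k = x"
  by (simp add: suf_def)

lemma length_suf: "k \<le> length x \<Longrightarrow> length (suf x k) = k"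
  by (simp add: suf_def)

lemma suf_suffix:
  assumes "j \<le> k"
  shows "\<exists>z. suf x k = z @ suf x j"
proof -
  have "suf x k = take (k - j) (suf x k) @ drop (k - j) (suf x k)" by simp
  moreover have "drop (k - j) (suf x k) = suf x j" if "k \<le> length x"
    using that assms by (simp add: suf_def)
  moreover have "suf x k = take (length x - j) x @ suf x j" if "\<not> k \<le> length x"
    using that take_append_suf by (simp add: suf_def)
  ultimately show ?thesis by metis
qed

lemma freq_suf_mono: "j \<le> k \<Longrightarrow> freq x (suf x k) b \<le> freq x (suf x j) b"
  using suf_suffix[of j k x] by (metis append.assoc freq_def occ_suffix_le)

text \<open>The stored contexts among the suffixes of x are exactly those with a further, non-final
  occurrence, so they are the suffixes up to some length.\<close>

lemma rel_lens_iff: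
  assumes "k \<ge> 1"
  shows "k \<in> rel_lens x \<longleftrightarrow> k \<le> length x \<and> (\<exists>b. freq x (suf x k) b > 0)"
proof
  assume "k \<in> rel_lens x"
  with assms have k: "k \<le> length x" and st: "stored x (suf x k)"
    by (auto simp: rel_lens_def)
  have "suf x k \<noteq> []" using assms length_suf[OF k] by auto
  with st k show "k \<le> length x \<and> (\<exists>b. freq x (suf x k) b > 0)"
    by (auto simp: stored_def freq_def)
next
  assume *: "k \<le> length x \<and> (\<exists>b. freq x (suf x k) b > 0)"
  then obtain b' u v where uv: "x = u @ (suf x k @ [b']) @ v"
    unfolding freq_def occ_pos_iff by blast
  obtain w b where wb: "suf x k = w @ [b]"
    using assms length_suf[of k x] * by (cases "suf x k" rule: rev_cases) auto
  have "x = take (length x - k) x @ w @ [b]"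
    using take_append_suf[of x k] wb by simp
  moreover have "x = u @ w @ ([b, b'] @ v)"
    using uv wb by simp
  moreover have "length u < length x - k"
    using arg_cong[OF uv, of length] length_suf[of k x] * by simp
  ultimately have "length (take (length x - k) x) \<in> occ_at w x" "length u \<in> occ_at w x"
      "length u < length x - k"
    unfolding occ_at_iff by blast+
  then have "{length u, length x - k} \<subseteq> occ_at w x" "length u \<noteq> length x - k"
    by simp_all
  then have "2 \<le> occ w x"
    unfolding occ_eq_card using card_mono[OF finite_occ_at, of "{length u, length x - k}" w x] by simp
  moreover have "occ (w @ [b, b']) x > 0"
    using uv wb by (intro occ_posI[of _ u _ v]) simp
  ultimately show "k \<in> rel_lens x"
    using * wb unfolding rel_lens_def stored_def by blast
qed

lemma zero_in_rel_lens [simp]: "0 \<in> rel_lens x"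
  by (simp add: rel_lens_def stored_def)

lemma finite_rel_lens [simp]: "finite (rel_lens x)"
  by (rule finite_subset[of _ "{..length x}"]) (auto simp: rel_lens_def)

lemma rel_lens_downward: "k \<in> rel_lens x \<Longrightarrow> j \<le> k \<Longrightarrow> j \<in> rel_lens x"
proof (cases "j = 0")
  case False
  assume "k \<in> rel_lens x" "j \<le> k"
  with False show ?thesis
    by (auto simp: rel_lens_iff intro: less_le_trans[OF _ freq_suf_mono])
qed simp

lemma cur_len_in: "cur_len x \<in> rel_lens x"
proof (cases "\<exists>k\<in>rel_lens x. esc x (suf x k) = 1")
  case True
  then have "Min {k \<in> rel_lens x. esc x (suf x k) = 1} \<in> {k \<in> rel_lens x. esc x (suf x k) = 1}"
    by (intro Min_in) auto
  with True show ?thesis by (simp add: cur_len_def)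
next
  case False
  moreover have "Max (rel_lens x) \<in> rel_lens x"
    using zero_in_rel_lens[of x] by (intro Max_in) (auto simp del: zero_in_rel_lens)
  ultimately show ?thesis by (simp add: cur_len_def)
qed

lemma esc_eq: "esc x c = (if freq x c False > 0 then 1 else 0) + (if freq x c True > 0 then 1 else 0)"
proof -
  have "{b. freq x c b > 0} =
      (if freq x c False > 0 then {False} else {}) \<union> (if freq x c True > 0 then {True} else {})"
    (is "?L = ?R")
  proof (rule set_eqI)
    show "b \<in> ?L \<longleftrightarrow> b \<in> ?R" for b by (cases b) auto
  qed
  then show ?thesis unfolding esc_def by auto
qed

lemma rel_list_eq:
  assumes "k \<in> rel_lens x"
  shows "rev (sorted_list_of_set {j \<in> rel_lens x. j \<le> k}) = rev [0..<Suc k]"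
proof -
  have "{j \<in> rel_lens x. j \<le> k} = {0..<Suc k}"
    using rel_lens_downward[OF assms] by auto
  then show ?thesis by simp
qed

lemma step_prob_eq: "step_prob x b = code_chain x b (rev [0..<Suc (cur_len x)])"
  unfolding step_prob_def using rel_list_eq[OF cur_len_in] by simp

lemma freq_le_tot: "freq x c b \<le> tot x c"
  by (cases b) (auto simp: tot_def)

lemma esc_prob_bounds: "0 < esc_prob x c" "esc_prob x c \<le> 1"
  by (auto simp: esc_prob_def esc_eq tot_def divide_simps split: if_splits)

lemma code_chain_bounds: "0 < code_chain x b ks \<and> code_chain x b ks \<le> 1"
proof (induction ks)
  case (Cons k ks)
  have "real (freq x (suf x k) b) \<le> real (tot x (suf x k) + esc x (suf x k))"
    using freq_le_tot[of x "suf x k" b] by linarith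
  with Cons show ?case
    using esc_prob_bounds[of x "suf x k"]
    by (auto simp: Let_def mult_le_one divide_simps)
qed simp

lemma step_prob_bounds: "0 < step_prob x b" "step_prob x b \<le> 1"
  using code_chain_bounds by (auto simp: step_prob_def)

text \<open>Contexts up to length K have seen both bits and are not deterministic, so coding starts
  at length at least K, with all denominators at most T + 2. A bit unseen in the current context
  makes that context deterministic; being the shortest such, its next shorter context has seen both
  bits. Thus there is at most one escape, which explains the square.\<close>

lemma step_prob_lower:
  assumes both: "\<And>w b. length w \<le> K \<Longrightarrow> freq x w b > 0"
    and few: "\<And>w. length w \<ge> K \<Longrightarrow> occ w x \<le> T"
    and K: "K \<le> length x"
  shows "1 / (real T + 2)\<^sup>2 \<le> step_prob x b"
proof -
  define k where "k = cur_len x"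
  have pos_short: "freq x (suf x j) a > 0" if "j \<le> K" for j a
    using that K length_suf[of j x] by (intro both) simp
  have in_rel: "j \<in> rel_lens x" if "j \<le> K" for j
  proof (cases "j = 0")
    case False
    then have "j \<ge> 1" by simp
    with that K pos_short[OF that] show ?thesis by (subst rel_lens_iff) auto
  qed simp
  have short: "esc x (suf x j) = 2" if "j \<le> K" for j
    using pos_short[OF that] by (simp add: esc_eq)
  have k_in: "k \<in> rel_lens x" using cur_len_in by (simp add: k_def)
  have det: "esc x (suf x k) = 1 \<and> (\<forall>j\<in>rel_lens x. j < k \<longrightarrow> esc x (suf x j) \<noteq> 1)"
    if ex: "\<exists>j\<in>rel_lens x. esc x (suf x j) = 1"
  proof -
    let ?D = "{j \<in> rel_lens x. esc x (suf x j) = 1}"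
    have "k = Min ?D" using ex by (simp add: k_def cur_len_def)
    then have "k \<in> ?D" "\<And>j. j \<in> ?D \<Longrightarrow> k \<le> j"
      using ex Min_in[of ?D] by auto
    then show ?thesis by force
  qed
  have kK: "K \<le> k"
  proof (cases "\<exists>j\<in>rel_lens x. esc x (suf x j) = 1")
    case True
    with det short[of k] show ?thesis by (cases "k \<le> K") auto
  next
    case False
    then have "k = Max (rel_lens x)" by (auto simp: k_def cur_len_def)
    then show ?thesis using in_rel[of K] by simp
  qed
  have denom: "real (tot x (suf x j) + esc x (suf x j)) \<le> real T + 2" if "K \<le> j" "j \<le> k" for j
  proof -
    have "j \<le> length x" using that k_in by (auto simp: rel_lens_def)
    then have "tot x (suf x j) \<le> T"
      using tot_le_occ[of x "suf x j"] few[of "suf x j"] that length_suf[of j x] by simp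
    moreover have "esc x (suf x j) \<le> 2" by (simp add: esc_eq)
    ultimately show ?thesis by linarith
  qed
  have found: "1 / (real T + 2) \<le> real (freq x (suf x j) b) / real (tot x (suf x j) + esc x (suf x j))"
    if "K \<le> j" "j \<le> k" "freq x (suf x j) b > 0" for j
    using that denom[OF that(1,2)] freq_le_tot[of x "suf x j" b] by (intro frac_le) auto
  have sq: "1 / (real T + 2)\<^sup>2 \<le> 1 / (real T + 2)"
    by (simp add: divide_simps power2_eq_square)
  have chain: "step_prob x b = code_chain x b (k # rev [0..<k])"
    by (simp add: step_prob_eq k_def)
  show ?thesis
  proof (cases "freq x (suf x k) b > 0")
    case True
    then show ?thesis
      using found[OF kK order_refl True] sq by (simp add: chain Let_def)
  next
    case False
    have "K < k" using False kK pos_short[of k b] by (cases "k = K") auto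
    then obtain j where k: "k = Suc j" by (cases k) auto
    obtain a where a: "freq x (suf x k) a > 0"
      using k_in k rel_lens_iff[of k x] by auto
    with False have "a = (\<not> b)" by (cases a; cases b) auto
    with a have nb: "freq x (suf x k) (\<not> b) > 0" by simp
    with False have esck: "esc x (suf x k) = 1"
      by (cases b) (simp_all add: esc_eq)
    have j_in: "j \<in> rel_lens x" using rel_lens_downward[OF k_in] k by simp
    have "esc x (suf x j) \<noteq> 1" using det esck k_in j_in k by auto
    moreover have "freq x (suf x j) (\<not> b) > 0"
      using nb freq_suf_mono[of j k x "\<not> b"] k by simp
    ultimately have pos: "freq x (suf x j) b > 0"
      by (cases b) (auto simp: esc_eq split: if_splits)
    have "1 / (real T + 2) \<le> esc_prob x (suf x k)"
      using denom[OF kK order_refl] esck by (auto simp: esc_prob_def intro!: frac_le)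
    moreover have "1 / (real T + 2) \<le> real (freq x (suf x j) b) / real (tot x (suf x j) + esc x (suf x j))"
      using found[of j] pos \<open>K < k\<close> k by simp
    ultimately have "(1 / (real T + 2)) * (1 / (real T + 2)) \<le>
        esc_prob x (suf x k) * (real (freq x (suf x j) b) / real (tot x (suf x j) + esc x (suf x j)))"
      using esc_prob_bounds(1)[of x "suf x k"] by (intro mult_mono) auto
    also have "\<dots> = step_prob x b"
      using False pos by (simp add: chain k Let_def)
    finally show ?thesis by (simp add: power2_eq_square)
  qed
qed

text \<open>A suffix followed only by b makes some relevant context deterministic, and the shortest such
  context is a suffix of it, hence predicts b at least as often.\<close>

lemma step_prob_predicted:
  assumes c: "c \<noteq> []" and fb: "freq (y @ c) c b \<ge> f" "f \<ge> 1" and nb: "freq (y @ c) c (\<not> b) = 0"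
  shows "real f / (real f + 1) \<le> step_prob (y @ c) b"
proof -
  let ?x = "y @ c" let ?k = "length c"
  let ?D = "{j \<in> rel_lens ?x. esc ?x (suf ?x j) = 1}"
  have k: "?k \<in> ?D"
    using c fb nb by (cases b) (auto simp: rel_lens_iff Suc_le_eq esc_eq intro!: exI[of _ b])
  have cur: "cur_len ?x = Min ?D"
    using k unfolding cur_len_def by auto
  have "finite ?D" by simp
  with cur k have "cur_len ?x \<in> ?D" and le: "cur_len ?x \<le> ?k"
    using Min_in[of ?D] Min_le[of ?D ?k] by (metis emptyE)+
  define d where "d = suf ?x (cur_len ?x)"
  have "f \<le> freq ?x d b"
    using freq_suf_mono[OF le, of ?x b] fb by (simp add: d_def)
  moreover have esc: "esc ?x d = 1" using \<open>cur_len ?x \<in> ?D\<close> by (simp add: d_def)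
  ultimately have tot: "tot ?x d = freq ?x d b" and f: "freq ?x d b > 0" "f \<le> freq ?x d b"
    using fb by (cases b; auto simp: esc_eq tot_def split: if_splits)+
  have "step_prob ?x b = real (freq ?x d b) / (real (freq ?x d b) + 1)"
    using f esc tot by (simp add: step_prob_eq Let_def d_def[symmetric])
  moreover have "real f / (real f + 1) \<le> real (freq ?x d b) / (real (freq ?x d b) + 1)"
  proof -
    have "real f * (real (freq ?x d b) + 1) \<le> real (freq ?x d b) * (real f + 1)"
      using f(2) by (simp add: algebra_simps)
    then show ?thesis by (simp add: divide_simps)
  qed
  ultimately show ?thesis by simp
qed

section \<open>Cost of a pass, a block and a prefix of S\<close>

definition bit_cost :: "bool list \<Rightarrow> bool \<Rightarrow> real" where
  "bit_cost x b = - log 2 (step_prob x b)"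

definition cost :: "bool list \<Rightarrow> real" where
  "cost y = (\<Sum>k<length y. bit_cost (take k y) (y ! k))"

lemma bit_cost_nonneg: "0 \<le> bit_cost x b"
  using step_prob_bounds[of x b] by (simp add: bit_cost_def)

lemma bit_cost_le_log:
  assumes "1 / r \<le> step_prob x b" "0 < r"
  shows "bit_cost x b \<le> log 2 r"
proof -
  have "log 2 (1 / r) \<le> log 2 (step_prob x b)"
    using assms by (subst log_le_cancel_iff) (auto intro: step_prob_bounds)
  then show ?thesis using assms by (simp add: bit_cost_def log_divide)
qed

lemma log_ppm_prob: "- log 2 (ppm_prob y) = cost y"
proof -
  have "ln (ppm_prob y) = (\<Sum>k<length y. ln (step_prob (take k y) (y ! k)))"
    unfolding ppm_prob_def by (rule ln_prod) (simp_all add: step_prob_bounds less_imp_neq[symmetric])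
  then show ?thesis
    by (simp add: cost_def bit_cost_def log_def sum_divide_distrib sum_negf)
qed

lemma cost_append: "cost (u @ v) = cost u + (\<Sum>k<length v. bit_cost (u @ take k v) (v ! k))"
proof -
  let ?f = "\<lambda>k. bit_cost (take k (u @ v)) ((u @ v) ! k)"
  have "cost (u @ v) = sum ?f {..<length u} + (\<Sum>k<length v. ?f (length u + k))"
    using sum.atLeastLessThan_concat[of 0 "length u" "length u + length v" ?f]
      sum.shift_bounds_nat_ivl[of ?f 0 "length u" "length v"]
    by (simp add: cost_def lessThan_atLeast0 add.commute del: take_append)
  then show ?thesis
    by (simp add: cost_def nth_append)
qed

lemma cost_append_mono: "cost u \<le> cost (u @ v)"
  unfolding cost_append by (simp add: sum_nonneg bit_cost_nonneg)

text \<open>The negative logarithm of the bound in \<open>step_prob_lower\<close> for T =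
  \<open>ctx_bound n\<close>; the factor 2 covers an escape followed by a prediction.\<close>

definition bit_bound :: "nat \<Rightarrow> real" where
  "bit_bound n = 2 * log 2 (real (ctx_bound n) + 2)"

lemma bit_bound_nonneg: "0 \<le> bit_bound n"
  by (simp add: bit_bound_def)

lemma length_S_upto_ge: "n * 2 ^ n \<le> length (S_upto n)"
  by (cases n) (simp_all add: S_upto_Suc length_Sblock)

lemma bit_cost_le:
  assumes n: "n \<ge> 5" and x: "S_upto n = x @ z" "x = S_upto (n - 1) @ y"
  shows "bit_cost x b \<le> bit_bound n"
proof -
  \<comment> \<open>The threshold n - 3 meets both demands: a word of this length extended by one
    bit has length n - 2 and occurs in \<open>S_upto (n - 1)\<close>, while the word itself is only
    3 letters short of n, as \<open>occ_S_upto_le\<close> requires.\<close>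
  have "1 / (real (ctx_bound n) + 2)\<^sup>2 \<le> step_prob x b"
  proof (rule step_prob_lower[of "n - 3"])
    fix w :: "bool list" and a
    assume "length w \<le> n - 3"
    then have "occ (w @ [a]) (S_upto (n - 1)) > 0"
      using n by (intro occ_S_upto_pos) auto
    then show "freq x w a > 0"
      using occ_append1[of "w @ [a]" "S_upto (n - 1)" y] x by (simp add: freq_def)
  next
    fix w :: "bool list"
    assume w: "n - 3 \<le> length w"
    have "occ w x \<le> occ (take (n - 3) w) (S_upto n)"
      using occ_take_le[of w x "n - 3"] occ_append1[of "take (n - 3) w" x z] x by simp
    also have "\<dots> \<le> ctx_bound n"
      using w n by (intro occ_S_upto_le) auto
    finally show "occ w x \<le> ctx_bound n" .
  next
    have "n - 1 \<le> (n - 1) * 2 ^ (n - 1)" by simp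
    also have "\<dots> \<le> length x" using length_S_upto_ge[of "n - 1"] x by simp
    finally show "n - 3 \<le> length x" by simp
  qed
  then have "bit_cost x b \<le> log 2 ((real (ctx_bound n) + 2)\<^sup>2)"
    by (intro bit_cost_le_log) auto
  then show ?thesis by (simp add: bit_bound_def log_nat_power)
qed

section \<open>Mispredictions and repetitions between passes\<close>

lemma occ_at_nth: "i \<in> occ_at w x \<Longrightarrow> j < length w \<Longrightarrow> x ! (i + j) = w ! j"
  by (auto simp: occ_at_iff nth_append)

text \<open>Two mispredicted positions cannot be witnessed by the same earlier occurrence: the longer
  matched word contains the correct bit where the shorter one diverges.\<close>

lemma card_mispredicted_le:
  "card {k. n \<le> k \<and> k < length d \<and> occ (take k d @ [\<not> d ! k]) (X @ take k d) > 0} \<le> occ (take n d) (X @ d)"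
    (is "card ?B \<le> _")
proof -
  define w where "w k = take k d @ [\<not> d ! k]" for k
  have "\<exists>q. q \<in> occ_at (w k) (X @ d)" if "k \<in> ?B" for k
  proof -
    have "occ (w k) (X @ take k d) > 0" using that by (simp add: w_def)
    also have "occ (w k) (X @ take k d) \<le> occ (w k) (X @ d)"
      using occ_append1[of "w k" "X @ take k d" "drop k d"] by simp
    finally show ?thesis by (auto simp: occ_eq_card card_gt_0_iff)
  qed
  then have "\<forall>k\<in>?B. \<exists>q. q \<in> occ_at (w k) (X @ d)" by blast
  then obtain q where "\<forall>k\<in>?B. q k \<in> occ_at (w k) (X @ d)"
    unfolding bchoice_iff by blast
  then have q: "q k \<in> occ_at (w k) (X @ d)" if "k \<in> ?B" for k
    using that by blast
  have distinct: False if "k \<in> ?B" "k' \<in> ?B" "q k = q k'" "k < k'" for k k'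
  proof -
    have "k' < length d" using that(2) by simp
    with that(4) have len: "length (take k d) = k" "length (take k' d) = k'"
      by simp_all
    have w1: "w k ! k = (\<not> d ! k)"
      unfolding w_def nth_append len by simp
    have w2: "w k' ! k = d ! k"
      unfolding w_def nth_append len using that(4) by simp
    have w3: "k < length (w k)"
      unfolding w_def length_append len by simp
    have w4: "k < length (w k')"
      unfolding w_def length_append len using that(4) by simp
    have "(X @ d) ! (q k + k) = w k ! k" "(X @ d) ! (q k' + k) = w k' ! k"
      using occ_at_nth[OF q[OF that(1)] w3] occ_at_nth[OF q[OF that(2)] w4] .
    then show False unfolding that(3) w1 w2 by blast
  qed
  have inj: "inj_on q ?B"
  proof (rule inj_onI)
    fix k k' assume kk': "k \<in> ?B" "k' \<in> ?B" "q k = q k'"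
    show "k = k'"
      using distinct[OF kk'] distinct[OF kk'(2,1) kk'(3)[symmetric]]
      by (cases k k' rule: linorder_cases) auto
  qed
  \<comment> \<open>Since k >= n, every witness begins with the first n bits of \<open>d\<close>, so
    all of them are counted among the occurrences of one fixed word.\<close>
  have "q ` ?B \<subseteq> occ_at (take n d) (X @ d)"
  proof
    fix i assume "i \<in> q ` ?B"
    then obtain k where k: "k \<in> ?B" "i = q k" by blast
    obtain u v where uv: "X @ d = u @ w k @ v" "length u = i"
      using q[OF k(1)] unfolding k(2) by (rule occ_atE)
    have "w k = take n d @ (drop n (take k d) @ [\<not> d ! k])"
      using k append_take_drop_id[of n "take k d"] by (simp add: w_def min_def)
    with uv(1) have "X @ d = u @ take n d @ (drop n (take k d) @ [\<not> d ! k] @ v)"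
      by simp
    with uv(2) show "i \<in> occ_at (take n d) (X @ d)"
      unfolding occ_at_iff by blast
  qed
  then have "card (q ` ?B) \<le> occ (take n d) (X @ d)"
    unfolding occ_eq_card by (intro card_mono) auto
  then show ?thesis using inj by (simp add: card_image)
qed

text \<open>Rotations only advance, by at most n positions in total. The first 2^n - n bits of pass
  p therefore come from db(n) without wrapping around, and lie inside the unwrapped initial part of
  the earlier pass.\<close>

lemma occ_in_earlier_pass:
  assumes n: "n \<ge> 1" and p: "p' \<le> p" "p \<le> n" and k: "k \<le> 2 ^ n - n"
  shows "occ (take k (pass n p)) (pass n p') \<ge> 1"
proof -
  define a a' where "a = p div odd_part n" and "a' = p' div odd_part n"
  have a: "a' \<le> a" "a \<le> n"
    unfolding a_def a'_def using p div_le_mono[of p' p "odd_part n"] div_le_dividend[of p "odd_part n"]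
    by linarith+
  have "k \<le> length (drop a (db n))"
    using a k less_exp[of n] unfolding length_drop length_db[OF n] by linarith
  then have "take k (pass n p) = take k (drop a (db n))"
    by (simp add: pass_def db_rot_def a_def[symmetric])
  moreover have "drop a (db n) = drop (a - a') (drop a' (db n))"
    using a by simp
  then have "drop a' (db n) = take (a - a') (drop a' (db n)) @ take k (drop a (db n)) @ drop k (drop a (db n))"
    unfolding append_take_drop_id by (simp del: drop_drop)
  then have "pass n p' = take (a - a') (drop a' (db n)) @ take k (drop a (db n))
      @ (drop k (drop a (db n)) @ take a' (db n))"
    by (simp add: pass_def db_rot_def a'_def[symmetric])
  ultimately have "occ (take k (pass n p)) (pass n p') > 0"
    by (intro occ_posI) auto
  then show ?thesis by simp
qed

lemma occ_in_earlier_passes: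
  assumes n: "n \<ge> 1" and p: "p \<le> n" and k: "0 < k" "k \<le> 2 ^ n - n"
  shows "p \<le> occ (take k (pass n p)) (concat (map (pass n) [0..<p]))"
proof -
  let ?w = "take k (pass n p)"
  have w: "?w \<noteq> []" using k length_pass[OF n, of p] by auto
  have "q \<le> occ ?w (concat (map (pass n) [0..<q]))" if "q \<le> p" for q
    using that
  proof (induction q)
    case (Suc q)
    then have "1 \<le> occ ?w (pass n q)"
      using n p k by (intro occ_in_earlier_pass) auto
    with Suc occ_append_ge[OF w, of "concat (map (pass n) [0..<q])" "pass n q"] show ?case by simp
  qed simp
  then show ?thesis by simp
qed

lemma S_upto_pass_split:
  assumes "n \<ge> 1" "p < n"
  shows "\<exists>z. S_upto n = S_upto (n - 1) @ concat (map (pass n) [0..<p]) @ pass n p @ z"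
proof -
  have "[0..<n] = [0..<p] @ p # [Suc p..<n]"
    using assms upt_conv_Cons[of p n] upt_add_eq_append[of 0 p "n - p"] by simp
  then have "Sblock n = concat (map (pass n) [0..<p]) @ pass n p @ concat (map (pass n) [Suc p..<n])"
    using Sblock_passes[OF assms(1)] by simp
  moreover have "S_upto n = S_upto (n - 1) @ Sblock n"
    using S_upto_Suc[of "n - 1"] assms by simp
  ultimately show ?thesis by auto
qed

lemma pass_bit_cost_le:
  assumes n: "n \<ge> 5" and p: "p < n" and k: "k < 2 ^ n"
  shows "bit_cost ((S_upto (n - 1) @ concat (map (pass n) [0..<p])) @ take k (pass n p)) b \<le> bit_bound n"
proof -
  obtain z where z: "S_upto n = S_upto (n - 1) @ concat (map (pass n) [0..<p]) @ pass n p @ z"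
    using S_upto_pass_split[of n p] n p by auto
  show ?thesis
    by (rule bit_cost_le[OF n, of _ "drop k (pass n p) @ z" "concat (map (pass n) [0..<p]) @ take k (pass n p)"])
      (simp_all add: z)
qed

lemma pass_cost_le:
  assumes n: "n \<ge> 5" and p: "1 \<le> p" "p < n"
  defines "X \<equiv> S_upto (n - 1) @ concat (map (pass n) [0..<p])"
  shows "(\<Sum>k<2 ^ n. bit_cost (X @ take k (pass n p)) (pass n p ! k))
    \<le> 2 ^ n * log 2 (1 + 1 / real p) + real (ctx_bound n + 2 * n) * bit_bound n"
proof -
  define d where "d = pass n p"
  have len: "length d = 2 ^ n" using n by (simp add: d_def length_pass)
  define B where "B = {k. n \<le> k \<and> k < length d \<and> occ (take k d @ [\<not> d ! k]) (X @ take k d) > 0}"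
  \<comment> \<open>Besides the mispredicted positions, E contains the first n, too early for
    \<open>card_mispredicted_le\<close>, and the last n, where the pass may have wrapped around and
    earlier passes need not agree.\<close>
  define E where "E = B \<union> {..<n} \<union> {2 ^ n - n..<2 ^ n}"
  have finB: "finite B" by (rule finite_subset[of _ "{..<length d}"]) (auto simp: B_def)
  have n2: "n < 2 ^ n" by (rule less_exp)
  have "card B \<le> occ (take n d) (X @ d)"
    unfolding B_def by (rule card_mispredicted_le)
  also have "\<dots> \<le> occ (take n d) (S_upto n)"
  proof -
    obtain z where "S_upto n = S_upto (n - 1) @ concat (map (pass n) [0..<p]) @ pass n p @ z"
      using S_upto_pass_split[of n p] n p by auto
    then have "S_upto n = (X @ d) @ z" by (simp add: X_def d_def)
    then show ?thesis using occ_append1 by metis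
  qed
  also have "\<dots> \<le> ctx_bound n"
    using n n2 len by (intro occ_S_upto_le) auto
  finally have "card B \<le> ctx_bound n" .
  moreover have "card E \<le> card B + card {..<n} + card {2 ^ n - n..<2 ^ n :: nat}"
    unfolding E_def by (meson card_Un_le add_le_mono1 order_trans)
  ultimately have cardE: "card E \<le> ctx_bound n + 2 * n" using n2 by simp
  have bit: "bit_cost (X @ take k d) (d ! k) \<le> log 2 (1 + 1 / real p) + (if k \<in> E then bit_bound n else 0)"
    if k: "k < 2 ^ n" for k
  proof (cases "k \<in> E")
    case True
    have "0 \<le> log 2 (1 + 1 / real p)" by (subst zero_le_log_cancel_iff) (auto intro: add_pos_nonneg)
    then show ?thesis
      using True pass_bit_cost_le[OF n p(2) k, of "d ! k"] by (simp add: X_def d_def)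
  next
    case False
    then have k': "n \<le> k" "k < 2 ^ n - n" and nb: "occ (take k d @ [\<not> d ! k]) (X @ take k d) = 0"
      using k len by (auto simp: E_def B_def)
    \<comment> \<open>The context followed by the correct bit is again a prefix of the pass, so its
      repetition in the p earlier passes counts correct predictions.\<close>
    have snoc: "take k d @ [d ! k] = take (Suc k) d"
      using k len by (simp add: take_Suc_conv_app_nth)
    have "p \<le> occ (take (Suc k) d) (concat (map (pass n) [0..<p]))"
      unfolding d_def using n p k' by (intro occ_in_earlier_passes) auto
    also have "\<dots> \<le> occ (take (Suc k) d) (X @ take k d)"
      unfolding X_def by (metis occ_append1 occ_append2 order_trans)
    finally have "p \<le> freq (X @ take k d) (take k d) (d ! k)"
      by (simp add: freq_def snoc)
    then have "real p / (real p + 1) \<le> step_prob (X @ take k d) (d ! k)"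
      using n p k' nb len by (intro step_prob_predicted) (auto simp: freq_def)
    moreover have "real p / (real p + 1) = 1 / (1 + 1 / real p)"
      using p by (simp add: divide_simps)
    ultimately have "bit_cost (X @ take k d) (d ! k) \<le> log 2 (1 + 1 / real p)"
      using p by (intro bit_cost_le_log) (auto intro: add_pos_nonneg)
    with False show ?thesis by simp
  qed
  have "(\<Sum>k<2 ^ n. bit_cost (X @ take k d) (d ! k))
      \<le> (\<Sum>k<2 ^ n. log 2 (1 + 1 / real p) + (if k \<in> E then bit_bound n else 0))"
    by (intro sum_mono bit) auto
  also have "\<dots> = 2 ^ n * log 2 (1 + 1 / real p) + real (card ({..<2 ^ n} \<inter> E)) * bit_bound n"
    by (simp add: sum.distrib sum.If_cases)
  also have "\<dots> \<le> 2 ^ n * log 2 (1 + 1 / real p) + real (ctx_bound n + 2 * n) * bit_bound n"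
  proof -
    have "card ({..<2 ^ n} \<inter> E) \<le> card E"
      using finB by (intro card_mono) (auto simp: E_def)
    with cardE have "card ({..<2 ^ n} \<inter> E) \<le> ctx_bound n + 2 * n" by linarith
    then show ?thesis
      by (intro add_left_mono mult_right_mono bit_bound_nonneg) (simp only: of_nat_le_iff)
  qed
  finally show ?thesis by (simp add: d_def)
qed

text \<open>Pass 0 is charged \<open>bit_bound n\<close> for every bit. The logarithm of p collects
  the terms log(1 + 1/q) of the later passes q, and the last summand their exceptional
  positions.\<close>

lemma cost_passes_le:
  assumes n: "n \<ge> 5" and p: "1 \<le> p" "p \<le> n"
  shows "cost (S_upto (n - 1) @ concat (map (pass n) [0..<p]))
    \<le> cost (S_upto (n - 1)) + 2 ^ n * (bit_bound n + log 2 (real p))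
      + real p * (real (ctx_bound n + 2 * n) * bit_bound n)"
  using p
proof (induction p rule: nat_induct_at_least)
  case base
  have "cost (S_upto (n - 1) @ pass n 0) = cost (S_upto (n - 1)) +
      (\<Sum>k<2 ^ n. bit_cost (S_upto (n - 1) @ take k (pass n 0)) (pass n 0 ! k))"
    using n by (simp add: cost_append length_pass)
  also have "(\<Sum>k<2 ^ n. bit_cost (S_upto (n - 1) @ take k (pass n 0)) (pass n 0 ! k))
      \<le> (\<Sum>k<(2::nat) ^ n. bit_bound n)"
    using n pass_bit_cost_le[OF n, of 0] by (intro sum_mono) auto
  finally show ?case by (simp add: bit_bound_nonneg add_increasing2)
next
  case (Suc p)
  have "log 2 (real p) + log 2 (1 + 1 / real p) = log 2 (real p * (1 + 1 / real p))"
    using Suc.hyps by (subst log_mult_pos) (auto simp: add_pos_nonneg)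
  also have "real p * (1 + 1 / real p) = real (Suc p)"
    using Suc.hyps by (simp add: field_simps)
  finally have logs: "log 2 (real (Suc p)) = log 2 (real p) + log 2 (1 + 1 / real p)" ..
  have "cost (S_upto (n - 1) @ concat (map (pass n) [0..<Suc p]))
      = cost (S_upto (n - 1) @ concat (map (pass n) [0..<p]))
        + (\<Sum>k<2 ^ n. bit_cost ((S_upto (n - 1) @ concat (map (pass n) [0..<p])) @ take k (pass n p)) (pass n p ! k))"
    using n cost_append[of "S_upto (n - 1) @ concat (map (pass n) [0..<p])" "pass n p"]
    by (simp add: length_pass)
  also have "\<dots> \<le> cost (S_upto (n - 1)) + 2 ^ n * (bit_bound n + log 2 (real p))
      + real p * (real (ctx_bound n + 2 * n) * bit_bound n)
      + (2 ^ n * log 2 (1 + 1 / real p) + real (ctx_bound n + 2 * n) * bit_bound n)"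
    using Suc by (intro add_mono pass_cost_le[OF n]) auto
  also have "\<dots> = cost (S_upto (n - 1)) + 2 ^ n * (bit_bound n + log 2 (real (Suc p)))
      + real (Suc p) * (real (ctx_bound n + 2 * n) * bit_bound n)"
    unfolding logs by (simp add: algebra_simps)
  finally show ?case .
qed

section \<open>Summation over blocks and passage to the limit\<close>

lemma cost_S_upto_step:
  assumes "n \<ge> 5"
  shows "cost (S_upto n) \<le> cost (S_upto (n - 1)) + 2 ^ n * (bit_bound n + log 2 (real n))
      + real n * (real (ctx_bound n + 2 * n) * bit_bound n)"
  using cost_passes_le[OF assms, of n] S_upto_Suc[of "n - 1"] Sblock_passes[of n] assms by simp

lemma ctx_bound_mono: "m \<le> n \<Longrightarrow> ctx_bound m \<le> ctx_bound n"
  unfolding ctx_bound_def by (intro mult_le_mono) auto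

lemma bit_bound_mono: "m \<le> n \<Longrightarrow> bit_bound m \<le> bit_bound n"
  using ctx_bound_mono[of m n] by (simp add: bit_bound_def)

text \<open>The factor 2^(n+1) dominates the geometric sum of the block factors 2^m for m <= n; the
  outer factor n in the second summand counts the blocks.\<close>

definition cost_bound :: "nat \<Rightarrow> real" where
  "cost_bound n = 2 ^ (n + 1) * (bit_bound n + log 2 (real n))
    + real n * (real n * (real (ctx_bound n + 2 * n) * bit_bound n))"

text \<open>The per-block estimate starts at block 5, so the first four blocks enter as a constant.
  In later blocks the logarithmic and polynomial factors are replaced by their values at n.\<close>

lemma cost_S_upto_le:
  assumes n: "n \<ge> 4"
  shows "cost (S_upto n) \<le> cost (S_upto 4) + cost_bound n"
proof -
  define U where "U = bit_bound n + log 2 (real n)"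
  define V where "V = real n * (real (ctx_bound n + 2 * n) * bit_bound n)"
  have U: "0 \<le> U" and V: "0 \<le> V"
    using n by (simp_all add: U_def V_def bit_bound_nonneg)
  have "cost (S_upto m) \<le> cost (S_upto 4) + 2 ^ (m + 1) * U + real m * V"
    if "4 \<le> m" "m \<le> n" for m
    using that
  proof (induction m rule: nat_induct_at_least)
    case base
    then show ?case using U V by simp
  next
    case (Suc m)
    have "cost (S_upto (Suc m)) \<le> cost (S_upto m)
        + 2 ^ Suc m * (bit_bound (Suc m) + log 2 (real (Suc m)))
        + real (Suc m) * (real (ctx_bound (Suc m) + 2 * Suc m) * bit_bound (Suc m))"
      using cost_S_upto_step[of "Suc m"] Suc.hyps by simp
    also have "\<dots> \<le> cost (S_upto m) + 2 ^ Suc m * U + V"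
      unfolding U_def V_def using Suc.prems ctx_bound_mono[of "Suc m" n] bit_bound_mono[of "Suc m" n]
      by (intro add_mono mult_mono order_refl) (auto simp: bit_bound_nonneg)
    also have "\<dots> \<le> cost (S_upto 4) + 2 ^ (Suc m + 1) * U + real (Suc m) * V"
      using Suc by (simp add: algebra_simps)
    finally show ?case .
  qed
  from this[of n] n show ?thesis by (simp add: cost_bound_def U_def V_def)
qed

text \<open>The denominator is a lower bound for the length of S_1...S_(n-1): a prefix ending inside
  block n may be barely longer than that, yet is charged for the whole block. The numerator is O(2^n
  log n).\<close>

lemma cost_bound_small:
  "(\<lambda>n. (cost_bound n + C) / (real (n - 1) * 2 ^ (n - 1))) \<longlonglongrightarrow> 0"
proof -
  define q :: "nat \<Rightarrow> real" where "q n = real n * (real n + 1) * (30 + 2 * real n)" for n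
  \<comment> \<open>\<open>g\<close> restates the quotient in real arithmetic, without truncated
    subtraction or casts of compound natural numbers, for the asymptotic computation.\<close>
  define g where "g n = (2 ^ (n + 1) * (2 * log 2 (q n + 2) + log 2 (real n))
    + real n * (real n * ((q n + 2 * real n) * (2 * log 2 (q n + 2)))) + C) / ((real n - 1) * (2 ^ n / 2))" for n
  have "g \<longlonglongrightarrow> 0"
    unfolding g_def q_def log_def by real_asymp
  moreover have "eventually (\<lambda>n. g n = (cost_bound n + C) / (real (n - 1) * 2 ^ (n - 1))) sequentially"
    using eventually_ge_at_top[of 1]
  proof eventually_elim
    case (elim n)
    have "real (ctx_bound n) = q n"
      unfolding ctx_bound_def q_def by (simp add: algebra_simps)
    moreover have "real (n - 1) = real n - 1" "2 ^ (n - 1) = (2 ^ n / 2 :: real)"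
      using elim by (auto simp: of_nat_diff power_diff)
    ultimately show ?case
      by (simp only: g_def cost_bound_def bit_bound_def of_nat_add of_nat_mult of_nat_numeral)
  qed
  ultimately show ?thesis by (rule Lim_transform_eventually)
qed

lemma S_prefix_split:
  assumes "m \<ge> 1"
  shows "\<exists>n z. S_upto n = S_prefix m @ z \<and> length (S_upto (n - 1)) < m \<and> m \<le> length (S_upto n)"
proof -
  have "m \<le> m * 2 ^ m" by simp
  then have ex: "m \<le> length (S_upto m)" using length_S_upto_ge[of m] by linarith
  define n where "n = (LEAST n. m \<le> length (S_upto n))"
  have n: "m \<le> length (S_upto n)" "n \<le> m"
    unfolding n_def using ex by (auto intro: LeastI Least_le)
  have "n \<noteq> 0" using n assms by (cases n) auto
  then have less: "length (S_upto (n - 1)) < m"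
    using not_less_Least[of "n - 1" "\<lambda>n. m \<le> length (S_upto n)"] by (simp add: n_def)
  \<comment> \<open>\<open>S_prefix m\<close> is cut from S_1...S_m, of which
    \<open>S_upto n\<close> is an initial part already containing m bits.\<close>
  have "[1..<Suc m] = [1..<Suc n] @ [Suc n..<Suc m]"
    using n(2) upt_add_eq_append[of 1 "Suc n" "m - n"] by simp
  then have "S_prefix m = take m (S_upto n)"
    using n(1) by (simp add: S_prefix_def S_upto_def del: upt_Suc)
  then have "S_upto n = S_prefix m @ drop m (S_upto n)" by simp
  with n less show ?thesis by blast
qed

lemma length_S_upto_mono: "m \<le> n \<Longrightarrow> length (S_upto m) \<le> length (S_upto n)"
  by (rule lift_Suc_mono_le) (simp_all add: S_upto_Suc)

text \<open>Bit costs are nonnegative, so a prefix ending inside block n costs at most as much as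
  all blocks up to n, while its length exceeds that of the blocks up to n - 1.\<close>

lemma cost_S_prefix_small:
  assumes "e > 0"
  shows "eventually (\<lambda>m. cost (S_prefix m) + C \<le> e * real m) sequentially"
proof -
  have "eventually (\<lambda>n. (cost_bound n + (cost (S_upto 4) + C)) / (real (n - 1) * 2 ^ (n - 1)) < e) sequentially"
    using cost_bound_small assms by (rule order_tendstoD)
  then have "eventually (\<lambda>n. n \<ge> 4 \<and> (cost_bound n + (cost (S_upto 4) + C)) / (real (n - 1) * 2 ^ (n - 1)) < e) sequentially"
    by (intro eventually_conj eventually_ge_at_top)
  then obtain N where N: "\<And>n. n \<ge> N \<Longrightarrow>
      n \<ge> 4 \<and> (cost_bound n + (cost (S_upto 4) + C)) / (real (n - 1) * 2 ^ (n - 1)) < e"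
    by (auto simp: eventually_sequentially)
  have "cost (S_prefix m) + C \<le> e * real m" if m: "m > length (S_upto N)" for m
  proof -
    obtain n z where nz: "S_upto n = S_prefix m @ z" "length (S_upto (n - 1)) < m" "m \<le> length (S_upto n)"
      using S_prefix_split[of m] m by auto
    have "N \<le> n"
      using m nz(3) length_S_upto_mono[of n N] by (rule_tac ccontr) auto
    note n = N[OF this]
    have "cost (S_prefix m) + C \<le> cost (S_upto n) + C"
      using cost_append_mono[of "S_prefix m" z] nz by simp
    also have "\<dots> \<le> cost_bound n + (cost (S_upto 4) + C)"
      using cost_S_upto_le[of n] n by simp
    also have "\<dots> \<le> e * (real (n - 1) * 2 ^ (n - 1))"
    proof -
      have "0 < real (n - 1) * 2 ^ (n - 1)" using n by simp
      with n show ?thesis by (simp only: pos_divide_less_eq less_imp_le)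
    qed
    also have "real (n - 1) * 2 ^ (n - 1) = real ((n - 1) * 2 ^ (n - 1))" by simp
    also have "e * \<dots> \<le> e * real m"
      using length_S_upto_ge[of "n - 1"] nz(2) assms by (intro mult_left_mono) linarith+
    finally show ?thesis .
  qed
  then show ?thesis
    by (intro eventually_mono[OF eventually_gt_at_top[of "length (S_upto N)"]])
qed

theorem theorem2:
  fixes L :: "bool list \<Rightarrow> nat" and c :: real
  assumes "\<forall>y. real (L y) \<le> real_of_int \<lceil>- log 2 (ppm_prob y)\<rceil> + c"
  shows "limsup (\<lambda>m. ereal (real (L (S_prefix m)) / real m)) = 0"
proof -
  \<comment> \<open>Rounding up adds at most one bit, so the overhead is the constant 1 + c, which
    vanishes after division by m.\<close>
  have L: "real (L y) \<le> cost y + (1 + c)" for y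
    using assms[rule_format, of y] of_int_ceiling_le_add_one[of "cost y"]
    unfolding log_ppm_prob by linarith
  have "(\<lambda>m. real (L (S_prefix m)) / real m) \<longlonglongrightarrow> 0"
  proof (rule LIMSEQ_I)
    fix r :: real
    assume r: "0 < r"
    then have "eventually (\<lambda>m. cost (S_prefix m) + (1 + c) \<le> r / 2 * real m \<and> m > 0) sequentially"
      by (intro eventually_conj cost_S_prefix_small eventually_gt_at_top) simp
    then have "eventually (\<lambda>m. norm (real (L (S_prefix m)) / real m - 0) < r) sequentially"
    proof eventually_elim
      case (elim m)
      with L[of "S_prefix m"] have "real (L (S_prefix m)) \<le> r / 2 * real m" by linarith
      with elim r have "real (L (S_prefix m)) / real m \<le> r / 2"
        by (simp add: pos_divide_le_eq)
      with r have "real (L (S_prefix m)) / real m < r" by linarith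
      then show ?case by simp
    qed
    then show "\<exists>N. \<forall>m\<ge>N. norm (real (L (S_prefix m)) / real m - 0) < r"
      by (simp add: eventually_sequentially)
  qed
  then have "(\<lambda>m. ereal (real (L (S_prefix m)) / real m)) \<longlonglongrightarrow> ereal 0"
    by (rule tendsto_ereal)
  then show ?thesis
    unfolding zero_ereal_def by (intro lim_imp_Limsup) simp_all
qed

end
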